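(* For $n\ge1$ let $F_{2n-1}:=s_{\delta_n/\delta_{n-2}}$, and let $\mathcal F:=\sum_{n\ge1}F_{2n-1}$, a formal power series in the variables $x_1,x_2,\ldots$. Then $$\mathcal F=\frac{e_1-e_3+e_5-\cdots}{1-e_2+e_4-\cdots},$$ where $e_k=\sum_{i_1<\cdots<i_k}x_{i_1}\cdots x_{i_k}$ is the $k$-th elementary symmetric function.
   Context: $\delta_n=(n,n-1,\ldots,2,1)$ is the staircase partition; $\delta_0$ and $\delta_{-1}$ are the empty partition. The diagram of a partition $\lambda$ has $\lambda_i$ cells in row $i$ (rows numbered top to bottom), left justified; the skew shape $\lambda/\mu$ is obtained by removing the diagram of $\mu$ from that of $\lambda\supseteq\mu$. A semistandard Young tableau of shape $\lambda/\mu$ is a filling of its cells by positive integers, weakly increasing along rows and strictly increasing down columns. The skew Schur function is $s_{\lambda/\mu}=\sum_T x^T$ over all such $T$, where $x^T=\prod_i x_i^{a_i}$ and $a_i$ is the number of entries equal to $i$. *)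

theory Defs
  imports "HOL-Library.Multiset"
begin

section \<open>Formal power series in arbitrarily many variables\<close>

text \<open>
  A monomial in variables indexed by \<open>'v\<close> is a finitely supported exponent vector, represented
  as a multiset over \<open>'v\<close> (the exponent of \<open>x\<^sub>i\<close> is \<open>count m i\<close>). A formal power series is an
  arbitrary assignment of coefficients to monomials.
\<close>

typedef ('v, 'a) mfps = "UNIV :: ('v multiset \<Rightarrow> 'a) set"
  morphisms coeff Abs_mfps
  by simp

lemma coeff_Abs_mfps [simp]: "coeff (Abs_mfps f) = f"
  by (simp add: Abs_mfps_inverse)

lemma mfps_eqI: "(\<And>m. coeff f m = coeff g m) \<Longrightarrow> f = g"
  by (metis coeff_inject ext)

lemma finite_subseteq_mset [simp]: "finite {a. a \<subseteq># (m :: 'v multiset)}"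
proof (induction m)
  case empty
  then show ?case by simp
next
  case (add x m)
  have "{a. a \<subseteq># add_mset x m} \<subseteq> {a. a \<subseteq># m} \<union> add_mset x ` {a. a \<subseteq># m}"
  proof
    fix a assume "a \<in> {a. a \<subseteq># add_mset x m}"
    hence a: "a \<subseteq># add_mset x m" by simp
    show "a \<in> {a. a \<subseteq># m} \<union> add_mset x ` {a. a \<subseteq># m}"
    proof (cases "x \<in># a")
      case True
      then obtain b where "a = add_mset x b" by (metis insert_DiffM)
      then show ?thesis using a by auto
    next
      case False
      then have "a \<subseteq># m" using a
        by (metis add_mset_remove_trivial diff_single_trivial mset_subset_eqI subset_eq_diff_conv
            add_mset_add_single)
      then show ?thesis by simp
    qed
  qed
  then show ?case using add by (meson finite_UnI finite_imageI finite_subset)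
qed

lemma diff_diff_mset: "a \<subseteq># m \<Longrightarrow> m - (m - a) = (a :: 'v multiset)"
  by (simp add: multiset_eq_iff subseteq_mset_def)

instantiation mfps :: (type, comm_ring_1) comm_ring_1
begin

definition "0 = Abs_mfps (\<lambda>_. 0)"
definition "1 = Abs_mfps (\<lambda>m. if m = {#} then 1 else 0)"
definition "f + g = Abs_mfps (\<lambda>m. coeff f m + coeff g m)"
definition "- f = Abs_mfps (\<lambda>m. - coeff f m)"
definition "f - g = Abs_mfps (\<lambda>m. coeff f m - coeff g m)"
definition "f * g = Abs_mfps (\<lambda>m. \<Sum>a | a \<subseteq># m. coeff f a * coeff g (m - a))"

instance
proof
  fix f g h :: "('a, 'b) mfps"
  have sum0: "(\<Sum>a | a \<subseteq># m. (if a = {#} then 1 else 0) * coeff f (m - a)) = coeff f m" for m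
  proof -
    have "(\<Sum>a | a \<subseteq># m. (if a = {#} then 1 else 0) * coeff f (m - a))
        = (\<Sum>a | a \<subseteq># m. if a = {#} then coeff f m else 0)"
      by (intro sum.cong) auto
    then show ?thesis by (simp add: sum.delta)
  qed
  show "f * g * h = f * (g * h)"
  proof (rule mfps_eqI)
    fix m
    have "coeff (f * g * h) m
        = (\<Sum>a | a \<subseteq># m. \<Sum>b | b \<subseteq># a. coeff f b * coeff g (a - b) * coeff h (m - a))"
      by (simp add: times_mfps_def sum_distrib_right)
    also have "\<dots> = (\<Sum>(a, b) \<in> (SIGMA a:{a. a \<subseteq># m}. {b. b \<subseteq># a}).
        coeff f b * coeff g (a - b) * coeff h (m - a))"
      by (simp add: sum.Sigma)
    also have "\<dots> = (\<Sum>(b, c) \<in> (SIGMA b:{b. b \<subseteq># m}. {c. c \<subseteq># m - b}).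
        coeff f b * (coeff g c * coeff h (m - b - c)))"
    proof (rule sum.reindex_bij_witness
        [where i = "\<lambda>(b, c). (b + c, b)" and j = "\<lambda>(a, b). (b, a - b)"], goal_cases)
      case (1 x)
      then obtain a b where "x = (a, b)" "a \<subseteq># m" "b \<subseteq># a" by auto
      then show ?case by simp
    next
      case (2 x)
      then obtain a b where x: "x = (a, b)" "a \<subseteq># m" "b \<subseteq># a" by auto
      then have "b \<subseteq># m" "a - b \<subseteq># m - b"
        by (meson subset_mset.order_trans) (use x in \<open>simp add: subseteq_mset_def diff_le_mono\<close>)
      with x show ?case by simp
    next
      case (3 y)
      then show ?case by (cases y) simp
    next
      case (4 y)
      then obtain b c where y: "y = (b, c)" "b \<subseteq># m" "c \<subseteq># m - b" by auto
      have "b + c \<subseteq># m"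
        unfolding subseteq_mset_def
      proof
        fix z
        from y have "count b z \<le> count m z" "count c z \<le> count m z - count b z"
          by (metis mset_subset_eq_count count_diff)+
        then show "count (b + c) z \<le> count m z" by simp
      qed
      with y show ?case by simp
    next
      case (5 x)
      then obtain a b where x: "x = (a, b)" "a \<subseteq># m" "b \<subseteq># a" by auto
      then have "m - b - (a - b) = m - a"
        by (metis diff_diff_add_mset subset_mset.add_diff_inverse)
      with x show ?case by (simp add: mult.assoc)
    qed
    also have "\<dots> = coeff (f * (g * h)) m"
      by (simp add: times_mfps_def sum_distrib_left sum.Sigma)
    finally show "coeff (f * g * h) m = coeff (f * (g * h)) m" .
  qed
  show "f * g = g * f"
  proof (rule mfps_eqI)
    fix m
    show "coeff (f * g) m = coeff (g * f) m"
      unfolding times_mfps_def coeff_Abs_mfps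
      by (rule sum.reindex_bij_witness[where i = "\<lambda>a. m - a" and j = "\<lambda>a. m - a"])
         (auto simp: mult.commute diff_diff_mset)
  qed
  show "1 * f = f"
    by (rule mfps_eqI) (simp add: times_mfps_def one_mfps_def sum0)
  show "(f + g) * h = f * h + g * h"
    by (rule mfps_eqI) (simp add: times_mfps_def plus_mfps_def sum.distrib distrib_right)
  show "(0 :: ('a, 'b) mfps) \<noteq> 1"
  proof
    assume "(0 :: ('a, 'b) mfps) = 1"
    then have "coeff (0 :: ('a, 'b) mfps) {#} = coeff 1 {#}" by simp
    then show False by (simp add: one_mfps_def zero_mfps_def)
  qed
qed (auto intro!: mfps_eqI simp: plus_mfps_def zero_mfps_def uminus_mfps_def minus_mfps_def)

end


definition monom :: "'v multiset \<Rightarrow> ('v, 'a::comm_ring_1) mfps" where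
  "monom m = Abs_mfps (\<lambda>k. if k = m then 1 else 0)"

definition var :: "'v \<Rightarrow> ('v, 'a::comm_ring_1) mfps" where
  "var i = monom {#i#}"

text \<open>
  A series is a unit iff it divides \<open>1\<close>, and its inverse is then unique; non-units get the
  inverse \<open>0\<close> by convention. See \<open>coeff_empty_1_imp_unit\<close> and \<open>mult_inverse_mfps\<close> below.
\<close>

instantiation mfps :: (type, comm_ring_1) inverse
begin

definition "inverse f = (if f dvd 1 then THE g. f * g = 1 else (0 :: ('a, 'b) mfps))"
definition "f div g = f * inverse (g :: ('a, 'b) mfps)"

instance ..

end

lemma mult_inverse_mfps:
  fixes f :: "('v, 'a::comm_ring_1) mfps"
  assumes "f dvd 1"
  shows "f * inverse f = 1"
proof -
  from assms obtain g where g: "f * g = 1" by (metis dvdE)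
  have "f * (THE g. f * g = 1) = 1"
  proof (rule theI)
    show "f * g = 1" by (rule g)
    show "h = g" if "f * h = 1" for h
    proof -
      have "h = h * (f * g)" using g by simp
      also have "\<dots> = (f * h) * g" by (simp only: ac_simps)
      finally show ?thesis using that by simp
    qed
  qed
  then show ?thesis using assms by (simp add: inverse_mfps_def)
qed

lemma mfps_divide_eq_iff:
  fixes f g h :: "('v, 'a::comm_ring_1) mfps"
  assumes "g dvd 1"
  shows "f / g = h \<longleftrightarrow> f = h * g"
proof
  assume "f / g = h"
  then have "h * g = f * (g * inverse g)" by (auto simp: divide_mfps_def ac_simps)
  then show "f = h * g" using assms by (simp add: mult_inverse_mfps)
next
  assume "f = h * g"
  then have "f / g = h * (g * inverse g)" by (simp add: divide_mfps_def ac_simps)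
  then show "f / g = h" using assms by (simp add: mult_inverse_mfps)
qed

function inv_coeff :: "('v, 'a::comm_ring_1) mfps \<Rightarrow> 'v multiset \<Rightarrow> 'a" where
  "inv_coeff f m = (if m = {#} then 1 else
     - (\<Sum>a\<in>{a. a \<subseteq># m \<and> a \<noteq> {#}}. coeff f a * inv_coeff f (m - a)))"
  by pat_completeness auto
termination
proof (relation "measure (size \<circ> snd)", goal_cases)
  case (2 f m a)
  then have "0 < size a" "size a \<le> size m"
    by (auto simp: size_mset_mono nonempty_has_size)
  with 2 show ?case by (simp add: size_Diff_submset)
qed simp

declare inv_coeff.simps [simp del]

lemma coeff_empty_1_imp_unit:
  fixes f :: "('v, 'a::comm_ring_1) mfps"
  assumes "coeff f {#} = 1"
  shows "f dvd 1"
proof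
  show "1 = f * Abs_mfps (inv_coeff f)"
  proof (rule mfps_eqI)
    fix m :: "'v multiset"
    have "coeff (f * Abs_mfps (inv_coeff f)) m
        = (\<Sum>a\<in>insert {#} {a. a \<subseteq># m \<and> a \<noteq> {#}}. coeff f a * inv_coeff f (m - a))"
      unfolding times_mfps_def coeff_Abs_mfps by (intro sum.cong) auto
    also have "\<dots> = inv_coeff f m
        + (\<Sum>a | a \<subseteq># m \<and> a \<noteq> {#}. coeff f a * inv_coeff f (m - a))"
      using assms by (subst sum.insert) (auto intro: finite_subset[OF _ finite_subseteq_mset])
    also have "\<dots> = coeff 1 m"
      by (cases "m = {#}") (use inv_coeff.simps[of f m] in \<open>auto simp: one_mfps_def\<close>)
    finally show "coeff 1 m = coeff (f * Abs_mfps (inv_coeff f)) m" by simp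
  qed
qed


section \<open>Infinite sums of formal power series\<close>

text \<open>
  A family is summable if every monomial occurs in only finitely many members; the sum is then
  formed coefficientwise. In a family that is not summable, the offending coefficients of
  \<open>formal_sum\<close> are \<open>0\<close>; all families used below are proved to be summable.
\<close>

definition formal_summable :: "('i \<Rightarrow> ('v, 'a::comm_ring_1) mfps) \<Rightarrow> 'i set \<Rightarrow> bool" where
  "formal_summable f I \<longleftrightarrow> (\<forall>m. finite {i \<in> I. coeff (f i) m \<noteq> 0})"

definition formal_sum :: "('i \<Rightarrow> ('v, 'a::comm_ring_1) mfps) \<Rightarrow> 'i set \<Rightarrow> ('v, 'a) mfps" where
  "formal_sum f I = Abs_mfps (\<lambda>m. \<Sum>i\<in>{i \<in> I. coeff (f i) m \<noteq> 0}. coeff (f i) m)"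


section \<open>Skew Schur functions and elementary symmetric functions\<close>

text \<open>
  The variables are \<open>x\<^sub>i = var i\<close> for \<open>i \<ge> 1\<close>; the index type \<^typ>\<open>nat\<close> also provides
  \<open>var 0\<close>, which occurs in none of the series below.
  Partitions are lists of parts, and cells are pairs (row, column), counted from 1.
\<close>

definition diagram :: "nat list \<Rightarrow> (nat \<times> nat) set" where
  "diagram p = {(i, j). 1 \<le> i \<and> i \<le> length p \<and> 1 \<le> j \<and> j \<le> p ! (i - 1)}"

definition skew_diagram :: "nat list \<Rightarrow> nat list \<Rightarrow> (nat \<times> nat) set" where
  "skew_diagram p q = diagram p - diagram q"

text \<open>
  Fillings of a set of cells \<open>D\<close> are functions on all pairs that vanish outside \<open>D\<close>, so that each
  tableau is represented by exactly one function.
\<close>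

definition ssyt :: "(nat \<times> nat) set \<Rightarrow> (nat \<times> nat \<Rightarrow> nat) set" where
  "ssyt D = {T.
     (\<forall>c\<in>D. 1 \<le> T c) \<and> (\<forall>c. c \<notin> D \<longrightarrow> T c = 0) \<and>
     (\<forall>i j j'. (i, j) \<in> D \<and> (i, j') \<in> D \<and> j < j' \<longrightarrow> T (i, j) \<le> T (i, j')) \<and>
     (\<forall>i i' j. (i, j) \<in> D \<and> (i', j) \<in> D \<and> i < i' \<longrightarrow> T (i, j) < T (i', j))}"

definition tableau_weight ::
    "(nat \<times> nat) set \<Rightarrow> (nat \<times> nat \<Rightarrow> nat) \<Rightarrow> (nat, 'a::comm_ring_1) mfps" where
  "tableau_weight D T = (\<Prod>i\<in>T ` D. var i ^ card {c \<in> D. T c = i})"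

definition skew_schur :: "nat list \<Rightarrow> nat list \<Rightarrow> (nat, 'a::comm_ring_1) mfps" where
  "skew_schur p q =
     formal_sum (tableau_weight (skew_diagram p q)) (ssyt (skew_diagram p q))"

definition esym :: "nat \<Rightarrow> (nat, 'a::comm_ring_1) mfps" where
  "esym k = formal_sum (\<lambda>S. \<Prod>i\<in>S. var i) {S. S \<subseteq> {1..} \<and> finite S \<and> card S = k}"

text \<open>The index is an integer because \<open>\<delta>\<^bsub>-1\<^esub>\<close> occurs; it is empty, like \<open>\<delta>\<^sub>0\<close>.\<close>

definition staircase :: "int \<Rightarrow> nat list" where
  "staircase n = rev (map nat [1..n])"


section \<open>Well-definedness\<close>

lemma coeff_one: "coeff 1 m = (if m = {#} then 1 else 0)"
  by (simp add: one_mfps_def)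

lemma coeff_uminus: "coeff (- f) m = - coeff f m"
  by (simp add: uminus_mfps_def)

lemma coeff_monom: "coeff (monom m) k = (if k = m then 1 else 0)"
  by (simp add: monom_def)

lemma monom_empty: "monom {#} = 1"
  by (simp add: monom_def one_mfps_def)

lemma monom_mult: "monom a * monom b = (monom (a + b) :: ('v, 'a::comm_ring_1) mfps)"
proof (rule mfps_eqI)
  fix m :: "'v multiset"
  have "coeff (monom a * monom b :: ('v, 'a) mfps) m
      = (\<Sum>c | c \<subseteq># m. if c = a then (if m - a = b then 1 else 0) else 0)"
    unfolding times_mfps_def coeff_Abs_mfps by (intro sum.cong) (auto simp: coeff_monom)
  also have "\<dots> = (if a \<subseteq># m then (if m - a = b then 1 else 0) else 0)"
    by (simp add: sum.delta)
  also have "\<dots> = coeff (monom (a + b)) m"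
    by (auto simp: coeff_monom)
  finally show "coeff (monom a * monom b :: ('v, 'a) mfps) m = coeff (monom (a + b)) m" .
qed

lemma var_power: "var i ^ k = monom (replicate_mset k i)"
  by (induction k) (simp_all add: monom_empty var_def monom_mult)

lemma prod_monom: "(\<Prod>i\<in>A. monom (f i)) = monom (\<Sum>i\<in>A. f i)"
  by (induction A rule: infinite_finite_induct) (simp_all add: monom_empty monom_mult)

lemma coeff_formal_sum_nonzeroE:
  assumes "coeff (formal_sum f I) m \<noteq> 0"
  obtains i where "i \<in> I" "coeff (f i) m \<noteq> 0"
proof -
  have "(\<Sum>i\<in>{i \<in> I. coeff (f i) m \<noteq> 0}. coeff (f i) m) \<noteq> 0"
    using assms by (simp add: formal_sum_def)
  then obtain i where "i \<in> {i \<in> I. coeff (f i) m \<noteq> 0}"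
    by (rule sum.not_neutral_contains_not_neutral)
  then show ?thesis using that by blast
qed

lemma coeff_sign_mult_nonzero:
  "coeff ((-1) ^ k * f) m \<noteq> 0 \<Longrightarrow> coeff f m \<noteq> (0 :: 'a::comm_ring_1)"
  by (cases "even k") (auto simp: coeff_uminus)

lemma coeff_prod_var_nonzero:
  assumes "coeff (\<Prod>i\<in>S. var i :: ('v, 'a::comm_ring_1) mfps) m \<noteq> 0"
  shows "m = mset_set S"
  using assms by (simp add: var_def prod_monom coeff_monom split: if_splits)

lemma formal_summable_esym:
  "formal_summable (\<lambda>S. \<Prod>i\<in>S. var i :: (nat, 'a::comm_ring_1) mfps)
     {S. S \<subseteq> {1..} \<and> finite S \<and> card S = k}"
  unfolding formal_summable_def
proof
  fix m :: "nat multiset"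
  show "finite {S \<in> {S. S \<subseteq> {1..} \<and> finite S \<and> card S = k}.
      coeff (\<Prod>i\<in>S. var i :: (nat, 'a) mfps) m \<noteq> 0}"
    by (rule finite_subset[of _ "{set_mset m}"]) (auto dest!: coeff_prod_var_nonzero)
qed

lemma coeff_esym_nonzero:
  assumes "coeff (esym k :: (nat, 'a::comm_ring_1) mfps) m \<noteq> 0"
  shows "size m = k"
proof -
  obtain S where "card S = k" "coeff (\<Prod>i\<in>S. var i :: (nat, 'a) mfps) m \<noteq> 0"
    using coeff_formal_sum_nonzeroE[OF assms[unfolded esym_def]] by blast
  then show ?thesis using coeff_prod_var_nonzero by force
qed

lemma esym_0: "esym 0 = (1 :: (nat, 'a::comm_ring_1) mfps)"
proof -
  have "{S. S \<subseteq> {1..} \<and> finite S \<and> card S = 0} = {{} :: nat set}"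
    by auto
  moreover have "{i. i = {} \<and> coeff (\<Prod>i\<in>i. var i :: (nat, 'a) mfps) m \<noteq> 0}
      = (if m = {#} then {{}} else {})" for m
    by (auto simp: coeff_one)
  ultimately show ?thesis
    by (intro mfps_eqI) (simp add: esym_def formal_sum_def coeff_one)
qed

lemma formal_summable_esym_odd:
  "formal_summable (\<lambda>k. (-1) ^ k * esym (2 * k + 1) :: (nat, 'a::comm_ring_1) mfps) UNIV"
  unfolding formal_summable_def
proof
  fix m :: "nat multiset"
  show "finite {k \<in> UNIV. coeff ((-1) ^ k * esym (2 * k + 1) :: (nat, 'a) mfps) m \<noteq> 0}"
    by (rule finite_subset[of _ "{..size m}"])
       (auto dest!: coeff_sign_mult_nonzero dest: coeff_esym_nonzero)
qed

lemma formal_summable_esym_even: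
  "formal_summable (\<lambda>k. (-1) ^ k * esym (2 * k) :: (nat, 'a::comm_ring_1) mfps) UNIV"
  unfolding formal_summable_def
proof
  fix m :: "nat multiset"
  show "finite {k \<in> UNIV. coeff ((-1) ^ k * esym (2 * k) :: (nat, 'a) mfps) m \<noteq> 0}"
    by (rule finite_subset[of _ "{..size m}"])
       (auto dest!: coeff_sign_mult_nonzero dest: coeff_esym_nonzero)
qed

lemma esym_even_unit:
  "formal_sum (\<lambda>k. (-1) ^ k * esym (2 * k)) UNIV dvd (1 :: (nat, 'a::comm_ring_1) mfps)"
proof (rule coeff_empty_1_imp_unit)
  have "{k. coeff ((-1) ^ k * esym (2 * k) :: (nat, 'a) mfps) {#} \<noteq> 0} = {0}"
    by (auto dest!: coeff_sign_mult_nonzero dest: coeff_esym_nonzero simp: esym_0 coeff_one)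
  then show "coeff (formal_sum (\<lambda>k. (-1) ^ k * esym (2 * k) :: (nat, 'a) mfps) UNIV) {#} = 1"
    by (simp add: formal_sum_def esym_0 coeff_one)
qed

lemma coeff_tableau_weight_nonzero:
  assumes "coeff (tableau_weight D T :: (nat, 'a::comm_ring_1) mfps) m \<noteq> 0" "finite D"
  shows "size m = card D" and "T ` D \<subseteq> set_mset m"
proof -
  have m: "m = (\<Sum>i\<in>T ` D. replicate_mset (card {c \<in> D. T c = i}) i)"
    using assms(1) by (simp add: tableau_weight_def var_power prod_monom coeff_monom split: if_splits)
  have "size m = (\<Sum>i\<in>T ` D. card {c \<in> D. T c = i})"
    by (simp add: m size_multiset_sum)
  also have "\<dots> = card D"
    using sum.image_gen[OF assms(2), of "\<lambda>_. 1::nat" T] by simp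
  finally show "size m = card D" .
  show "T ` D \<subseteq> set_mset m"
    using assms(2) by (auto simp: m set_mset_sum card_gt_0_iff)
qed

lemma finite_skew_diagram: "finite (skew_diagram p q)"
proof -
  have "diagram p \<subseteq> (\<Union>i\<in>{1..length p}. {i} \<times> {1..p ! (i - 1)})"
    by (auto simp: diagram_def)
  then have "finite (diagram p)"
    by (rule finite_subset) auto
  then show ?thesis by (simp add: skew_diagram_def)
qed

lemma formal_summable_skew_schur:
  "formal_summable (tableau_weight (skew_diagram p q) :: _ \<Rightarrow> (nat, 'a::comm_ring_1) mfps)
     (ssyt (skew_diagram p q))"
  unfolding formal_summable_def
proof
  fix m :: "nat multiset"
  let ?D = "skew_diagram p q"
  show "finite {T \<in> ssyt ?D. coeff (tableau_weight ?D T :: (nat, 'a) mfps) m \<noteq> 0}"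
  proof (rule finite_subset)
    show "finite {T. \<forall>c. (c \<in> ?D \<longrightarrow> T c \<in> set_mset m) \<and> (c \<notin> ?D \<longrightarrow> T c = 0)}"
      by (rule finite_set_of_finite_funs) (simp_all add: finite_skew_diagram)
    show "{T \<in> ssyt ?D. coeff (tableau_weight ?D T :: (nat, 'a) mfps) m \<noteq> 0}
        \<subseteq> {T. \<forall>c. (c \<in> ?D \<longrightarrow> T c \<in> set_mset m) \<and> (c \<notin> ?D \<longrightarrow> T c = 0)}"
      using coeff_tableau_weight_nonzero(2)[OF _ finite_skew_diagram]
      by (fastforce simp: ssyt_def)
  qed
qed

lemma coeff_skew_schur_nonzero:
  assumes "coeff (skew_schur p q :: (nat, 'a::comm_ring_1) mfps) m \<noteq> 0"
  shows "size m = card (skew_diagram p q)"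
proof -
  obtain T where "coeff (tableau_weight (skew_diagram p q) T :: (nat, 'a) mfps) m \<noteq> 0"
    using assms[unfolded skew_schur_def] by (rule coeff_formal_sum_nonzeroE)
  then show ?thesis
    using finite_skew_diagram by (rule coeff_tableau_weight_nonzero(1))
qed

lemma length_staircase: "length (staircase n) = nat n"
  by (simp add: staircase_def)

lemma nth_staircase: "i < nat n \<Longrightarrow> staircase n ! i = nat n - i"
proof -
  assume i: "i < nat n"
  then have "[1..n] ! (nat n - Suc i) = 1 + int (nat n - Suc i)"
    by (intro nth_upto) linarith
  with i have "[1..n] ! (nat n - Suc i) = int (nat n - i)" by linarith
  with i show ?thesis by (simp add: staircase_def rev_nth del: of_nat_diff)
qed

lemma le_card_skew_staircase:
  "n \<le> card (skew_diagram (staircase (int n)) (staircase (int n - 2)))"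
proof -
  have "(\<lambda>i. (i, n + 1 - i)) ` {1..n} \<subseteq> skew_diagram (staircase (int n)) (staircase (int n - 2))"
    by (auto simp: skew_diagram_def diagram_def length_staircase nth_staircase)
  moreover have "card ((\<lambda>i. (i, n + 1 - i)) ` {1..n}) = n"
    by (subst card_image) (auto simp: inj_on_def)
  ultimately show ?thesis
    by (metis card_mono finite_skew_diagram)
qed

lemma formal_summable_skew_staircase:
  "formal_summable
     (\<lambda>n. skew_schur (staircase (int n)) (staircase (int n - 2)) :: (nat, 'a::comm_ring_1) mfps)
     {1..}"
  unfolding formal_summable_def
proof
  fix m :: "nat multiset"
  have "n \<le> size m"
    if "coeff (skew_schur (staircase (int n)) (staircase (int n - 2)) :: (nat, 'a) mfps) m \<noteq> 0" for n
    using coeff_skew_schur_nonzero[OF that] le_card_skew_staircase[of n] by simp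
  then have "{n \<in> {1..}.
      coeff (skew_schur (staircase (int n)) (staircase (int n - 2)) :: (nat, 'a) mfps) m \<noteq> 0}
        \<subseteq> {..size m}"
    by blast
  then show "finite {n \<in> {1..}.
      coeff (skew_schur (staircase (int n)) (staircase (int n - 2)) :: (nat, 'a) mfps) m \<noteq> 0}"
    by (rule finite_subset) simp
qed

end

theory Submission
  imports Defs
begin

text \<open>
  Read from bottom left to top right, the tableaux of shape \<open>\<delta>\<^sub>n/\<delta>\<^bsub>n-2\<^esub>\<close> are the words
  \<open>u\<^sub>1 > u\<^sub>2 \<le> u\<^sub>3 > \<dots> \<le> u\<^bsub>2n-1\<^esub>\<close>. After clearing the denominator, the left-hand side therefore
  enumerates pairs \<open>(v, u)\<close> of an increasing word \<open>v\<close> of even length \<open>2k\<close> and such an alternating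
  word \<open>u\<close>, with sign \<open>(-1)\<^sup>k\<close>. If \<open>v\<^sub>1 \<le> u\<^sub>1\<close>, move the first two letters of \<open>v\<close> to the front of
  \<open>u\<close>, in the order \<open>v\<^sub>2, v\<^sub>1\<close>; otherwise, if \<open>u\<close> has at least three letters, move two letters back.
  This involution reverses signs, and for the remaining pairs \<open>u\<close> is a single letter smaller than
  all letters of \<open>v\<close>, so that \<open>u\<^sub>1 v\<close> is an arbitrary increasing word of odd length.
\<close>

section \<open>Signed generating series\<close>

text \<open>Signs \<open>s\<close> and weights \<open>w\<close> are kept apart so that sign changes
  and bijections act independently. A sum over an infinite fibre of \<open>w\<close> is 0 by
  default, so results that split or multiply series need finite fibres.\<close>

definition gen_series ::
    "('b \<Rightarrow> 'a) \<Rightarrow> ('b \<Rightarrow> 'v multiset) \<Rightarrow> 'b set \<Rightarrow> ('v, 'a::comm_ring_1) mfps" where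
  "gen_series s w A = Abs_mfps (\<lambda>m. \<Sum>a | a \<in> A \<and> w a = m. s a)"

lemma coeff_gen_series: "coeff (gen_series s w A) m = (\<Sum>a | a \<in> A \<and> w a = m. s a)"
  by (simp add: gen_series_def)

lemma gen_series_reindex:
  assumes "bij_betw f A B" "\<And>a. a \<in> A \<Longrightarrow> w' (f a) = w a" "\<And>a. a \<in> A \<Longrightarrow> s' (f a) = s a"
  shows "gen_series s w A = gen_series s' w' B"
proof (rule mfps_eqI)
  fix m
  have "bij_betw f {a. a \<in> A \<and> w a = m} {b. b \<in> B \<and> w' b = m}"
    using assms(1,2) by (auto simp: bij_betw_def inj_on_def image_iff)
  then show "coeff (gen_series s w A) m = coeff (gen_series s' w' B) m"
    unfolding coeff_gen_series
    by (metis (mono_tags, lifting) assms(3) mem_Collect_eq sum.cong sum.reindex_bij_betw)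
qed

lemma gen_series_Un:
  assumes "\<And>m. finite {a \<in> A \<union> B. w a = m}" "A \<inter> B = {}"
  shows "gen_series s w (A \<union> B) = gen_series s w A + gen_series s w B"
proof (rule mfps_eqI)
  fix m
  have "{a. a \<in> A \<union> B \<and> w a = m} = {a. a \<in> A \<and> w a = m} \<union> {a. a \<in> B \<and> w a = m}"
    by auto
  moreover have "finite {a. a \<in> A \<and> w a = m}" "finite {a. a \<in> B \<and> w a = m}"
    by (rule finite_subset[OF _ assms(1)[of m]]; auto)+
  ultimately show "coeff (gen_series s w (A \<union> B)) m
      = coeff (gen_series s w A + gen_series s w B) m"
    using assms(2) by (simp add: coeff_gen_series plus_mfps_def) (rule sum.union_disjoint, auto)
qed

lemma gen_series_uminus: "gen_series (\<lambda>a. - s a) w A = - gen_series s w A"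
  by (rule mfps_eqI) (simp add: coeff_gen_series coeff_uminus sum_negf)

text \<open>The first weight is one of the finitely many submultisets \<open>c\<close> of
  \<open>m\<close>, and then the second weight must be \<open>m - c\<close>.\<close>

lemma finite_pair_fibre:
  fixes w :: "'b \<Rightarrow> 'v multiset" and v :: "'c \<Rightarrow> 'v multiset"
  assumes "\<And>m. finite {a \<in> A. w a = m}" "\<And>m. finite {b \<in> B. v b = m}"
  shows "finite {p \<in> A \<times> B. w (fst p) + v (snd p) = m}"
proof (rule finite_subset)
  show "{p \<in> A \<times> B. w (fst p) + v (snd p) = m}
      \<subseteq> (\<Union>c\<in>{c. c \<subseteq># m}. {a \<in> A. w a = c} \<times> {b \<in> B. v b = m - c})"
    by auto
  show "finite (\<Union>c\<in>{c. c \<subseteq># m}. {a \<in> A. w a = c} \<times> {b \<in> B. v b = m - c})"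
    using assms by auto
qed

text \<open>The Cauchy product groups pairs by the weight \<open>c\<close> of the first component;
  the groups are disjoint and finite, so they merge into one sum.\<close>

lemma gen_series_mult:
  assumes "\<And>m. finite {a \<in> A. w a = m}" "\<And>m. finite {b \<in> B. v b = m}"
  shows "gen_series s w A * gen_series t v B
    = gen_series (\<lambda>p. s (fst p) * t (snd p)) (\<lambda>p. w (fst p) + v (snd p)) (A \<times> B)"
proof (rule mfps_eqI)
  fix m
  let ?P = "\<lambda>c. {a. a \<in> A \<and> w a = c} \<times> {b. b \<in> B \<and> v b = m - c}"
  have "coeff (gen_series s w A * gen_series t v B) m
      = (\<Sum>c | c \<subseteq># m. \<Sum>p\<in>?P c. s (fst p) * t (snd p))"
    by (simp add: times_mfps_def coeff_gen_series sum_product sum.cartesian_product case_prod_beta)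
  also have "\<dots> = (\<Sum>p\<in>(\<Union>c\<in>{c. c \<subseteq># m}. ?P c). s (fst p) * t (snd p))"
    by (rule sum.UNION_disjoint[symmetric]) (use assms in auto)
  also have "(\<Union>c\<in>{c. c \<subseteq># m}. ?P c) = {p. p \<in> A \<times> B \<and> w (fst p) + v (snd p) = m}"
    by auto
  finally show "coeff (gen_series s w A * gen_series t v B) m
    = coeff (gen_series (\<lambda>p. s (fst p) * t (snd p)) (\<lambda>p. w (fst p) + v (snd p)) (A \<times> B)) m"
    by (simp add: coeff_gen_series)
qed

section \<open>Formal sums as generating series\<close>

lemma formal_sum_monom:
  "formal_sum (\<lambda>a. monom (w a)) A
    = (gen_series (\<lambda>_. 1) w A :: ('b, 'c::comm_ring_1) mfps)"
proof (rule mfps_eqI)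
  fix m
  have "{a \<in> A. coeff (monom (w a) :: ('b, 'c) mfps) m \<noteq> 0} = {a. a \<in> A \<and> w a = m}"
    by (auto simp: coeff_monom)
  then show "coeff (formal_sum (\<lambda>a. monom (w a)) A :: ('b, 'c) mfps) m
      = coeff (gen_series (\<lambda>_. 1) w A) m"
    by (simp add: formal_sum_def coeff_gen_series coeff_monom)
qed

lemma formal_sum_cong:
  assumes "\<And>i. i \<in> I \<Longrightarrow> f i = g i"
  shows "formal_sum f I = formal_sum g I"
  by (rule mfps_eqI) (auto simp: formal_sum_def assms intro!: sum.cong)

text \<open>The statistic \<open>g\<close> cuts \<open>A\<close> into slices. For a fixed monomial
  only the finitely many values of \<open>g\<close> on its fibre matter, so the slices can be summed
  up again.\<close>

lemma formal_sum_gen_series: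
  assumes "\<And>m. finite {a \<in> A. w a = m}"
  shows "formal_sum (\<lambda>i. gen_series s w {a \<in> A. g a = i}) I = gen_series s w {a \<in> A. g a \<in> I}"
proof (rule mfps_eqI)
  fix m
  let ?c = "\<lambda>i. \<Sum>a | (a \<in> A \<and> g a = i) \<and> w a = m. s a"
  let ?F = "{a. (a \<in> A \<and> g a \<in> I) \<and> w a = m}"
  have fin: "finite ?F"
    by (rule finite_subset[OF _ assms[of m]]) auto
  have "(\<Sum>i | i \<in> I \<and> ?c i \<noteq> 0. ?c i) = (\<Sum>i\<in>g ` ?F. ?c i)"
  \<comment> \<open>A slice whose signs cancel is missing on the left and contributes 0 on the
    right.\<close>
  proof (rule sum.mono_neutral_left)
    show "{i \<in> I. ?c i \<noteq> 0} \<subseteq> g ` ?F"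
    proof
      fix i assume i: "i \<in> {i \<in> I. ?c i \<noteq> 0}"
      then obtain a where "a \<in> A" "g a = i" "w a = m"
        using sum.not_neutral_contains_not_neutral[of s] by blast
      then show "i \<in> g ` ?F" using i by blast
    qed
  qed (use fin in auto)
  also have "\<dots> = (\<Sum>i\<in>g ` ?F. \<Sum>a | a \<in> ?F \<and> g a = i. s a)"
    by (intro sum.cong) auto
  also have "\<dots> = sum s ?F"
    using sum.image_gen[OF fin, of s g] by simp
  finally show "coeff (formal_sum (\<lambda>i. gen_series s w {a \<in> A. g a = i}) I) m
      = coeff (gen_series s w {a \<in> A. g a \<in> I}) m"
    by (simp add: formal_sum_def coeff_gen_series)
qed

section \<open>Elementary symmetric functions and increasing words\<close>

definition increasing_words :: "nat list set" where
  "increasing_words = {v. sorted_wrt (<) v \<and> 0 \<notin> set v}"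

lemma sum_single_mset: "(\<Sum>a\<in>A. {#f a#}) = image_mset f (mset_set A)"
  by (induction A rule: infinite_finite_induct) auto

lemma finite_mset_fibre: "finite {v \<in> A. mset v = m}"
  by (rule finite_subset[of _ "{v. set v \<subseteq> set_mset m \<and> length v = size m}"])
    (auto intro: finite_lists_length_eq)

text \<open>Sorting a finite set of positive integers gives its unique increasing word, and the
  product of its variables records the letters.\<close>

lemma esym_eq_gen_series:
  "esym k = gen_series (\<lambda>_. 1) mset {v \<in> increasing_words. length v = k}"
proof -
  have "bij_betw sorted_list_of_set {S. S \<subseteq> {1..} \<and> finite S \<and> card S = k}
      {v \<in> increasing_words. length v = k}"
    by (rule bij_betw_byWitness[where f' = set])
      (auto simp: increasing_words_def strict_sorted_iff distinct_card Suc_le_eq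
        intro: sorted_distinct_set_unique gr0I)
  moreover have "mset (sorted_list_of_set S) = mset_set S" if "finite S" for S :: "nat set"
    using that by (simp add: mset_set_set[symmetric])
  ultimately show ?thesis
    unfolding esym_def var_def prod_monom formal_sum_monom
    by (intro gen_series_reindex[of sorted_list_of_set])
      (auto simp: sum_single_mset[where f = id, simplified])
qed

text \<open>Covers numerator and denominator at once: both \<open>2 * k + 1\<close> and
  \<open>2 * k\<close> have half \<open>k\<close>, so the sign can be read off the length of the
  word.\<close>

lemma signed_esym_sum:
  assumes "\<And>k. f k div 2 = k"
  shows "formal_sum (\<lambda>k. (-1) ^ k * esym (f k)) UNIV
    = gen_series (\<lambda>v. (-1) ^ (length v div 2)) mset {v \<in> increasing_words. length v \<in> range f}"
proof -
  let ?W = "{v \<in> increasing_words. length v \<in> range f}"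
  have term_eq: "(-1) ^ k * esym (f k)
      = gen_series (\<lambda>v. (-1) ^ (length v div 2)) mset {v \<in> ?W. length v div 2 = k}" for k
  proof -
    have "(-1) ^ k * esym (f k)
        = gen_series (\<lambda>_. (-1) ^ k) mset {v \<in> increasing_words. length v = f k}"
      \<comment> \<open>The factor is 1 or -1, so negation of a series is enough.\<close>
      by (cases "even k") (simp_all add: esym_eq_gen_series gen_series_uminus)
    also have "{v \<in> increasing_words. length v = f k} = {v \<in> ?W. length v div 2 = k}"
      using assms by auto
    also have "gen_series (\<lambda>_. (-1) ^ k) mset {v \<in> ?W. length v div 2 = k}
        = gen_series (\<lambda>v. (-1) ^ (length v div 2)) mset {v \<in> ?W. length v div 2 = k}"
      by (rule gen_series_reindex[of id]) auto
    finally show ?thesis .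
  qed
  show ?thesis
    unfolding term_eq formal_sum_gen_series[OF finite_mset_fibre] by simp
qed

section \<open>Staircase ribbons and alternating words\<close>

text \<open>The recursion removes two letters from the front, just as the involution does; all such
  words have odd length.\<close>

fun alternating :: "nat list \<Rightarrow> bool" where
  "alternating [] \<longleftrightarrow> False"
| "alternating [x] \<longleftrightarrow> True"
| "alternating [x, y] \<longleftrightarrow> False"
| "alternating (x # y # z # u) \<longleftrightarrow> y < x \<and> y \<le> z \<and> alternating (z # u)"

lemma alternating_iff_nth:
  "alternating u \<longleftrightarrow> odd (length u) \<and>
    (\<forall>i. Suc i < length u \<longrightarrow> (if even i then u ! Suc i < u ! i else u ! i \<le> u ! Suc i))"
proof (induction u rule: alternating.induct)
  case (4 x y z u)
  show ?case unfolding alternating.simps 4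
    by (auto simp: All_less_Suc2 nth_Cons split: nat.splits)
qed auto

definition alternating_words :: "nat list set" where
  "alternating_words = {u. alternating u \<and> 0 \<notin> set u}"

section \<open>The ribbon and its reading order\<close>

text \<open>The cells of \<delta>_n satisfy i + j \<le> n + 1 and those of \<delta>_(n-2) satisfy i
  + j \<le> n - 1, which leaves two antidiagonals.\<close>

definition ribbon :: "nat \<Rightarrow> (nat \<times> nat) set" where
  "ribbon n = {(i, j). 1 \<le> i \<and> 1 \<le> j \<and> (i + j = n \<or> i + j = Suc n)}"

lemma skew_diagram_staircase:
  "skew_diagram (staircase (int n)) (staircase (int n - 2)) = ribbon n"
proof -
  have "(i, j) \<in> skew_diagram (staircase (int n)) (staircase (int n - 2)) \<longleftrightarrow> (i, j) \<in> ribbon n"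
    for i j
    \<comment> \<open>Parts can be looked up only in rows that exist, hence the split at the lengths
      of both staircases.\<close>
    by (cases "i = 0"; cases "n < i"; cases "n - 2 < i")
      (auto simp: skew_diagram_def diagram_def ribbon_def length_staircase nth_staircase)
  then show ?thesis by auto
qed

text \<open>Counting from 0 at the bottom left cell \<open>(n, 1)\<close>, the path goes up after an
  even index and right after an odd one, ending at \<open>(1, n)\<close>.\<close>

definition ribbon_cell :: "nat \<Rightarrow> nat \<Rightarrow> nat \<times> nat" where
  "ribbon_cell n k = (n - Suc k div 2, Suc (k div 2))"

text \<open>The number of steps up plus the number of steps right from
  \<open>(n, 1)\<close>.\<close>

definition ribbon_index :: "nat \<Rightarrow> nat \<times> nat \<Rightarrow> nat" where
  "ribbon_index n c = (n - fst c) + (snd c - 1)"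

lemma ribbon_index_cell:
  assumes "k < 2 * n - 1"
  shows "ribbon_index n (ribbon_cell n k) = k"
  by (cases "even k") (use assms in \<open>auto simp: ribbon_index_def ribbon_cell_def elim!: evenE oddE\<close>)

text \<open>Expressing \<open>n\<close> through the row and \<open>l\<close> on each antidiagonal
  eliminates truncated subtraction: the index becomes \<open>2 * l + 1\<close> or
  \<open>2 * l\<close>.\<close>

lemma ribbon_cellsE:
  assumes "c \<in> ribbon n"
  obtains i l where "1 \<le> i" "c = (i, Suc l)" "n = i + Suc l"
  | i l where "1 \<le> i" "c = (i, Suc l)" "n = i + l"
proof -
  obtain i j where c: "c = (i, j)" by fastforce
  then obtain l where "j = Suc l" using assms by (cases j) (auto simp: ribbon_def)
  then show thesis using assms c that by (auto simp: ribbon_def)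
qed

lemma ribbon_cell_index: "c \<in> ribbon n \<Longrightarrow> ribbon_cell n (ribbon_index n c) = c"
  by (erule ribbon_cellsE) (simp_all add: ribbon_index_def ribbon_cell_def flip: mult_2)

lemma ribbon_cell_in: "k < 2 * n - 1 \<Longrightarrow> ribbon_cell n k \<in> ribbon n"
  unfolding ribbon_cell_def ribbon_def by auto

lemma ribbon_index_less: "c \<in> ribbon n \<Longrightarrow> ribbon_index n c < 2 * n - 1"
  by (erule ribbon_cellsE) (simp_all add: ribbon_index_def)

lemma bij_betw_ribbon_cell: "bij_betw (ribbon_cell n) {..<2 * n - 1} (ribbon n)"
  by (rule bij_betw_byWitness[where f' = "ribbon_index n"])
    (auto simp: ribbon_index_cell ribbon_cell_index ribbon_cell_in ribbon_index_less
      simp del: One_nat_def)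

lemma finite_ribbon: "finite (ribbon n)"
  using bij_betw_ribbon_cell bij_betw_finite by blast

lemma mset_sum_const: "(\<Sum>a\<in>A. {#x#}) = replicate_mset (card A) x"
  by (induction A rule: infinite_finite_induct) auto

section \<open>Ribbon tableaux as alternating words\<close>

text \<open>The weight groups the cells by entry; ungrouping them gives the multiset of all
  entries.\<close>

lemma tableau_weight_eq_monom:
  assumes "finite D"
  shows "tableau_weight D T = monom (image_mset T (mset_set D))"
proof -
  have "(\<Sum>i\<in>T ` D. replicate_mset (card {c \<in> D. T c = i}) i)
      = (\<Sum>i\<in>T ` D. \<Sum>c | c \<in> D \<and> T c = i. {#T c#})"
  proof (rule sum.cong[OF refl])
    fix i
    have "(\<Sum>c | c \<in> D \<and> T c = i. {#T c#}) = (\<Sum>c | c \<in> D \<and> T c = i. {#i#})"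
      by (rule sum.cong) auto
    then show "replicate_mset (card {c \<in> D. T c = i}) i = (\<Sum>c | c \<in> D \<and> T c = i. {#T c#})"
      by (simp add: mset_sum_const)
  qed
  also have "\<dots> = image_mset T (mset_set D)"
    using sum.image_gen[OF assms, of "\<lambda>c. {#T c#}" T] assms by (simp add: sum_single_mset)
  finally have "(\<Sum>i\<in>T ` D. replicate_mset (card {c \<in> D. T c = i}) i) = image_mset T (mset_set D)" .
  then show ?thesis
    by (simp add: tableau_weight_def var_power prod_monom)
qed

definition ribbon_word :: "nat \<Rightarrow> (nat \<times> nat \<Rightarrow> nat) \<Rightarrow> nat list" where
  "ribbon_word n T = map (T \<circ> ribbon_cell n) [0..<2 * n - 1]"

definition ribbon_tableau :: "nat \<Rightarrow> nat list \<Rightarrow> nat \<times> nat \<Rightarrow> nat" where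
  "ribbon_tableau n u c = (if c \<in> ribbon n then u ! ribbon_index n c else 0)"

text \<open>A step up in a column is a strict descent, and a step right in a row is a weak
  ascent.\<close>

lemma ribbon_word_alternating:
  assumes "T \<in> ssyt (ribbon n)" "1 \<le> n"
  shows "ribbon_word n T \<in> alternating_words"
proof -
  have "if even k then T (ribbon_cell n (Suc k)) < T (ribbon_cell n k)
      else T (ribbon_cell n k) \<le> T (ribbon_cell n (Suc k))" if k: "Suc k < 2 * n - 1" for k
  proof (cases "even k")
    case True
    then obtain l where l: "k = 2 * l" by blast
    have "(n - Suc l, Suc l) \<in> ribbon n" "(n - l, Suc l) \<in> ribbon n" "n - Suc l < n - l"
      using k l by (auto simp: ribbon_def)
    then have "T (n - Suc l, Suc l) < T (n - l, Suc l)"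
      using assms(1) unfolding ssyt_def by blast
    then show ?thesis using l by (simp add: ribbon_cell_def)
  next
    case False
    then obtain l where l: "k = Suc (2 * l)" by (metis oddE Suc_eq_plus1)
    have "(n - Suc l, Suc l) \<in> ribbon n" "(n - Suc l, Suc (Suc l)) \<in> ribbon n"
      using k l by (auto simp: ribbon_def)
    then have "T (n - Suc l, Suc l) \<le> T (n - Suc l, Suc (Suc l))"
      using assms(1) unfolding ssyt_def by blast
    then show ?thesis using l by (simp add: ribbon_cell_def)
  qed
  moreover have "1 \<le> T (ribbon_cell n k)" if "k < 2 * n - 1" for k
    using assms(1) ribbon_cell_in[OF that] by (simp add: ssyt_def)
  ultimately show ?thesis
    using assms(2)
    by (fastforce simp: alternating_words_def alternating_iff_nth ribbon_word_def)
qed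

text \<open>A row or column of the ribbon has at most two cells, and these are consecutive in
  reading order, so comparing neighbouring letters suffices.\<close>

lemma ribbon_tableau_ssyt:
  assumes "u \<in> alternating_words" "length u = 2 * n - 1"
  shows "ribbon_tableau n u \<in> ssyt (ribbon n)"
proof -
  have alt: "if even k then u ! Suc k < u ! k else u ! k \<le> u ! Suc k" if "Suc k < 2 * n - 1" for k
    using assms that by (auto simp: alternating_words_def alternating_iff_nth)
  have "1 \<le> u ! ribbon_index n c" if "c \<in> ribbon n" for c
    using ribbon_index_less[OF that] assms nth_mem[of "ribbon_index n c" u]
    by (cases "u ! ribbon_index n c") (auto simp: alternating_words_def)
  moreover have "u ! ribbon_index n (i, j) \<le> u ! ribbon_index n (i, j')"
    if "(i, j) \<in> ribbon n" "(i, j') \<in> ribbon n" "j < j'" for i j j'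
  proof -
    have "ribbon_index n (i, j') = Suc (ribbon_index n (i, j))" "odd (ribbon_index n (i, j))"
      using that by (auto simp: ribbon_def ribbon_index_def)
    then show ?thesis using alt ribbon_index_less[OF that(2)] by metis
  qed
  moreover have "u ! ribbon_index n (i, j) < u ! ribbon_index n (i', j)"
    if "(i, j) \<in> ribbon n" "(i', j) \<in> ribbon n" "i < i'" for i i' j
  proof -
    have "ribbon_index n (i, j) = Suc (ribbon_index n (i', j))" "even (ribbon_index n (i', j))"
      using that by (auto simp: ribbon_def ribbon_index_def)
    then show ?thesis using alt ribbon_index_less[OF that(1)] by metis
  qed
  ultimately show ?thesis
    by (auto simp: ssyt_def ribbon_tableau_def)
qed

lemma bij_betw_ribbon_word:
  assumes "1 \<le> n"
  shows "bij_betw (ribbon_word n) (ssyt (ribbon n)) {u \<in> alternating_words. length u = 2 * n - 1}"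
proof (rule bij_betw_byWitness[where f' = "ribbon_tableau n"])
  show "\<forall>T\<in>ssyt (ribbon n). ribbon_tableau n (ribbon_word n T) = T"
    by (auto simp: fun_eq_iff ribbon_tableau_def ribbon_word_def ribbon_index_less
        ribbon_cell_index ssyt_def simp del: One_nat_def)
  show "\<forall>u\<in>{u \<in> alternating_words. length u = 2 * n - 1}. ribbon_word n (ribbon_tableau n u) = u"
    by (auto simp: ribbon_tableau_def ribbon_word_def ribbon_cell_in ribbon_index_cell
        intro!: nth_equalityI)
qed (use assms ribbon_word_alternating ribbon_tableau_ssyt in \<open>auto simp: ribbon_word_def\<close>)

lemma mset_ribbon_word: "mset (ribbon_word n T) = image_mset T (mset_set (ribbon n))"
proof -
  have "mset_set (ribbon n) = image_mset (ribbon_cell n) (mset_set {..<2 * n - 1})"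
    using bij_betw_ribbon_cell[of n] by (simp add: bij_betw_def image_mset_mset_set)
  then show ?thesis
    by (simp add: ribbon_word_def image_mset.compositionality atLeast0LessThan)
qed

lemma skew_schur_staircase:
  assumes "1 \<le> n"
  shows "skew_schur (staircase (int n)) (staircase (int n - 2))
    = gen_series (\<lambda>_. 1) mset {u \<in> alternating_words. length u = 2 * n - 1}"
proof -
  have "skew_schur (staircase (int n)) (staircase (int n - 2))
      = gen_series (\<lambda>_. 1) (\<lambda>T. image_mset T (mset_set (ribbon n))) (ssyt (ribbon n))"
    unfolding skew_schur_def skew_diagram_staircase formal_sum_monom[symmetric]
    by (intro formal_sum_cong tableau_weight_eq_monom finite_ribbon)
  also have "\<dots> = gen_series (\<lambda>_. 1) mset {u \<in> alternating_words. length u = 2 * n - 1}"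
    by (rule gen_series_reindex[OF bij_betw_ribbon_word[OF assms]]) (simp_all add: mset_ribbon_word)
  finally show ?thesis .
qed

lemma sum_skew_schur_staircase:
  "formal_sum (\<lambda>n. skew_schur (staircase (int n)) (staircase (int n - 2))) {1..}
    = gen_series (\<lambda>_. 1) mset alternating_words"
proof -
  have odd: "odd (length u)" if "u \<in> alternating_words" for u
    using that by (simp add: alternating_words_def alternating_iff_nth)
  have "formal_sum (\<lambda>n. skew_schur (staircase (int n)) (staircase (int n - 2))) {1..}
      = (formal_sum (\<lambda>n. gen_series (\<lambda>_. 1) mset
          {u \<in> alternating_words. Suc (length u) div 2 = n}) {1..} :: (nat, 'a::comm_ring_1) mfps)"
  proof -
    \<comment> \<open>As lengths are odd, \<open>n\<close> is a function of the word, which turns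
      the sum over \<open>n\<close> into a sum over slices.\<close>
    have "{u \<in> alternating_words. length u = 2 * n - 1}
        = {u \<in> alternating_words. Suc (length u) div 2 = n}" if "1 \<le> n" for n
      using that odd by (auto elim!: oddE)
    then have "skew_schur (staircase (int n)) (staircase (int n - 2)) = (gen_series (\<lambda>_. 1) mset
          {u \<in> alternating_words. Suc (length u) div 2 = n} :: (nat, 'a) mfps)" if "1 \<le> n" for n
      using that by (simp add: skew_schur_staircase)
    then show ?thesis
      by (intro formal_sum_cong) simp
  qed
  also have "\<dots> = gen_series (\<lambda>_. 1) mset {u \<in> alternating_words. Suc (length u) div 2 \<in> {1..}}"
    by (rule formal_sum_gen_series) (rule finite_mset_fibre)
  also have "{u \<in> alternating_words. Suc (length u) div 2 \<in> {1..}} = alternating_words"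
    using odd by (auto elim!: oddE)
  finally show ?thesis .
qed

section \<open>The sign-reversing involution\<close>

text \<open>With \<open>a < b\<close> from the increasing word, \<open>a \<le> hd u\<close> is what
  makes \<open>b # a # u\<close> alternating.\<close>

definition movable_left :: "(nat list \<times> nat list) set" where
  "movable_left = {(a # b # v, u) | a b v u. a # b # v \<in> increasing_words \<and> even (length v) \<and>
     u \<in> alternating_words \<and> a \<le> hd u}"

text \<open>The condition \<open>b < hd v\<close> both makes \<open>a # b # v\<close> increasing and
  excludes the pairs of \<open>movable_left\<close>.\<close>

definition movable_right :: "(nat list \<times> nat list) set" where
  "movable_right = {(v, b # a # u) | a b v u. v \<in> increasing_words \<and> even (length v) \<and>
     b # a # u \<in> alternating_words \<and> (v = [] \<or> b < hd v)}"

definition unmovable :: "(nat list \<times> nat list) set" where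
  "unmovable = {(v, [x]) | v x. v \<in> increasing_words \<and> even (length v) \<and> 0 < x \<and>
     (v = [] \<or> x < hd v)}"

lemma pairs_decomposition:
  "{v \<in> increasing_words. even (length v)} \<times> alternating_words
    = unmovable \<union> (movable_left \<union> movable_right)"
proof (intro set_eqI iffI)
  fix p :: "nat list \<times> nat list"
  assume "p \<in> {v \<in> increasing_words. even (length v)} \<times> alternating_words"
  then obtain v u where p: "p = (v, u)" "v \<in> increasing_words" "even (length v)"
      "u \<in> alternating_words" by auto
  obtain x u' where u: "u = x # u'" using p(4) by (cases u) (auto simp: alternating_words_def)
  show "p \<in> unmovable \<union> (movable_left \<union> movable_right)"
  proof (cases "v = [] \<or> x < hd v")
    case True
    then show ?thesis using p u
      by (cases u') (auto simp: unmovable_def movable_right_def alternating_words_def)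
  next
    case False
    \<comment> \<open>A nonempty word of even length has two letters;
      \<open>alternating.cases\<close> serves only to split by length.\<close>
    then obtain a b v' where "v = a # b # v'" using p(3) by (cases v rule: alternating.cases) auto
    then show ?thesis using False p u by (auto simp: movable_left_def)
  qed
qed (auto simp: unmovable_def movable_left_def movable_right_def alternating_words_def)

lemma unmovable_disjoint: "unmovable \<inter> (movable_left \<union> movable_right) = {}"
  by (auto simp: unmovable_def movable_left_def movable_right_def)

lemma movable_disjoint: "movable_left \<inter> movable_right = {}"
  by (auto simp: movable_left_def movable_right_def)

fun move :: "nat list \<times> nat list \<Rightarrow> nat list \<times> nat list" where
  "move (a # b # v, u) = (v, b # a # u)"
| "move p = p"

fun move_back :: "nat list \<times> nat list \<Rightarrow> nat list \<times> nat list" where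
  "move_back (v, b # a # u) = (a # b # v, u)"
| "move_back p = p"

lemma increasing_words_Cons:
  "a # v \<in> increasing_words \<longleftrightarrow> v \<in> increasing_words \<and> 0 < a \<and> (v = [] \<or> a < hd v)"
  by (cases v) (auto simp: increasing_words_def)

lemma alternating_words_Cons_Cons:
  "b # a # u \<in> alternating_words \<longleftrightarrow> u \<in> alternating_words \<and> 0 < a \<and> a < b \<and> a \<le> hd u"
  by (cases u) (auto simp: alternating_words_def)

text \<open>Both sides impose the same inequalities \<open>a < b\<close>,
  \<open>a \<le> hd u\<close> and, for nonempty \<open>v\<close>, \<open>b < hd v\<close>; only the
  word that supplies them changes.\<close>

lemma bij_betw_move: "bij_betw move movable_left movable_right"
  by (rule bij_betw_byWitness[where f' = move_back])
    (auto simp: movable_left_def movable_right_def increasing_words_Cons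
      alternating_words_Cons_Cons)

theorem proposition3p4:
  shows "formal_sum (\<lambda>n::nat. skew_schur (staircase (int n)) (staircase (int n - 2))) {1..}
       = formal_sum (\<lambda>k::nat. (-1) ^ k * esym (2 * k + 1)) UNIV
         / (formal_sum (\<lambda>k::nat. (-1) ^ k * esym (2 * k)) UNIV :: (nat, int) mfps)"
proof -
  let ?sgn = "\<lambda>v :: nat list. (-1) ^ (length v div 2) :: int"
  \<comment> \<open>The factor 1 is the sign of the alternating word, kept to match the product
    formula literally.\<close>
  let ?s = "\<lambda>p :: nat list \<times> nat list. ?sgn (fst p) * 1"
  let ?w = "\<lambda>p :: nat list \<times> nat list. mset (fst p) + mset (snd p)"
  let ?V = "{v \<in> increasing_words. even (length v)}"
  have fin: "finite {p \<in> ?V \<times> alternating_words. ?w p = m}" for m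
    by (rule finite_pair_fibre) (rule finite_mset_fibre)+
  have even_range: "range (\<lambda>k. 2 * k) = Collect (even :: nat \<Rightarrow> bool)"
    by (auto elim!: evenE)
  have odd_range: "range (\<lambda>k. 2 * k + 1) = Collect (odd :: nat \<Rightarrow> bool)"
    by (auto elim!: oddE)
  \<comment> \<open>Moving two letters keeps the joint content and lowers half the length of the
    first word by one, which flips the sign.\<close>
  have cancel: "gen_series ?s ?w movable_left = - gen_series ?s ?w movable_right"
    unfolding gen_series_uminus[symmetric]
    by (rule gen_series_reindex[OF bij_betw_move]) (auto simp: movable_left_def)
  \<comment> \<open>Prepending the single letter to a word of even length leaves
    \<open>length v div 2\<close>, and so the sign, unchanged.\<close>
  have fixed: "gen_series ?s ?w unmovable
      = gen_series ?sgn mset {v \<in> increasing_words. odd (length v)}"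
  proof (rule gen_series_reindex)
    show "bij_betw (\<lambda>(v, u). hd u # v) unmovable {v \<in> increasing_words. odd (length v)}"
      by (rule bij_betw_byWitness[where f' = "\<lambda>v. (tl v, [hd v])"])
        (auto simp: unmovable_def increasing_words_Cons length_Suc_conv elim!: oddE)
  qed (auto simp: unmovable_def)
  have "formal_sum (\<lambda>k. (-1) ^ k * esym (2 * k)) UNIV
      * formal_sum (\<lambda>n. skew_schur (staircase (int n)) (staircase (int n - 2))) {1..}
      = gen_series ?sgn mset ?V * gen_series (\<lambda>_. 1) mset alternating_words"
    by (simp add: signed_esym_sum[of "\<lambda>k. 2 * k"] even_range sum_skew_schur_staircase
        del: One_nat_def)
  also have "\<dots> = gen_series ?s ?w (?V \<times> alternating_words)"
    by (rule gen_series_mult) (rule finite_mset_fibre)+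
  also have "\<dots> = gen_series ?s ?w unmovable + gen_series ?s ?w (movable_left \<union> movable_right)"
    unfolding pairs_decomposition
    by (rule gen_series_Un[OF _ unmovable_disjoint]) (rule fin[unfolded pairs_decomposition])
  also have "gen_series ?s ?w (movable_left \<union> movable_right)
      = gen_series ?s ?w movable_left + gen_series ?s ?w movable_right"
    by (rule gen_series_Un[OF _ movable_disjoint])
      (rule finite_subset[OF _ fin[unfolded pairs_decomposition]], auto)
  also have "gen_series ?s ?w unmovable + \<dots>
      = gen_series ?sgn mset {v \<in> increasing_words. odd (length v)}"
    by (simp only: cancel fixed) simp
  also have "\<dots> = formal_sum (\<lambda>k. (-1) ^ k * esym (2 * k + 1)) UNIV"
    by (subst signed_esym_sum, simp, simp only: odd_range mem_Collect_eq)
  finally show ?thesis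
    \<comment> \<open>The denominator has constant term 1 and is therefore a unit, so the quotient
      formula is equivalent to the product formula just shown.\<close>
    unfolding eq_commute[of "formal_sum _ {1..}"] mfps_divide_eq_iff[OF esym_even_unit]
    by (simp only: mult.commute)
qed

end
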